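(* Let $m\ge 1$ and let $k_1,\ldots,k_m$ and $n_1,\ldots,n_m$ be integers with $n_i \geq k_i > 0$ for all $i \in [m]$. Let $M$ be the complement of a $(k_1, \ldots, k_m; n_1, \ldots, n_m)$ circulant block diagonal matrix. For every $i \in [m]$, put $d_i = \gcd(n_i,k_i)$ if $n_i >k_i$, and $d_i = 1$ if $n_i=k_i$. Then \[\mathrm{rank}_{\mathrm{bin}}(M) \leq \mathrm{rank}_{\mathbb{R}}(M)+\max_{i \in [m]} d_i-1.\]
   Context: For integers $n \ge k \ge 0$, $D_{n,k}$ denotes the $n\times n$ circulant $0,1$ matrix whose first row consists of $n-k$ ones followed by $k$ zeros, each subsequent row being the cyclic shift of the previous row by one position to the right. For integers $n_i \ge k_i \ge 0$ ($i\in[m]$), a matrix is called $(k_1,\ldots,k_m;n_1,\ldots,n_m)$ circulant block diagonal if it is a block matrix with $m$ diagonal blocks whose $i$th diagonal block is $D_{n_i,n_i-k_i}$ (the $n_i\times n_i$ circulant matrix whose first row has $k_i$ ones followed by $n_i-k_i$ zeros) and all of whose other entries are zero. The complement $\overline{A}$ of a $0,1$ matrix $A$ is obtained by replacing ones by zeros and zeros by ones. The binary rank $\mathrm{rank}_{\mathrm{bin}}(A)$ of an $n\times n$ $0,1$ matrix $A$ is the smallest $r$ such that $A=A_1A_2$ (over the reals) with $A_1,A_2$ being $0,1$ matrices of dimensions $n\times r$ and $r\times n$; equivalently, the smallest number of combinatorial rectangles (sets $A'\times B'$ of rows and columns all of whose entries are ones) that partition the ones of $A$. $\mathrm{rank}_{\mathbb{R}}$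 denotes the rank over the reals. *)

theory Defs
  imports "Jordan_Normal_Form.DL_Rank"
begin

definition zero_one_mat :: "real mat \<Rightarrow> bool" where
  "zero_one_mat A \<longleftrightarrow> elements_mat A \<subseteq> {0, 1}"

text \<open>The matrix \<open>D\<^bsub>n,k\<^esub>\<close>, with indices counted from 0: row \<open>i\<close> is the first row
  (\<open>n - k\<close> ones, then \<open>k\<close> zeros) shifted cyclically \<open>i\<close> places to the right, so its entry in
  column \<open>j\<close> is the first-row entry at position \<open>(j - i) mod n\<close>. The summand \<open>n\<close> keeps the
  subtraction on natural numbers exact.\<close>

definition circ_mat :: "nat \<Rightarrow> nat \<Rightarrow> real mat" where
  "circ_mat n k = mat n n (\<lambda>(i, j). if (j + n - i) mod n < n - k then 1 else 0)"

definition circ_block_diag :: "nat \<Rightarrow> (nat \<Rightarrow> nat) \<Rightarrow> (nat \<Rightarrow> nat) \<Rightarrow> real mat" where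
  "circ_block_diag m k n = diag_block_mat (map (\<lambda>i. circ_mat (n i) (n i - k i)) [1..<m + 1])"

definition complement_mat :: "real mat \<Rightarrow> real mat" where
  "complement_mat A = map_mat (\<lambda>x. 1 - x) A"

text \<open>For 0,1 matrices the least \<open>r\<close> below exists, since \<open>A = A * 1\<close>.\<close>

definition binary_rank :: "real mat \<Rightarrow> nat" where
  "binary_rank A = (LEAST r. \<exists>A1 A2.
     A1 \<in> carrier_mat (dim_row A) r \<and> A2 \<in> carrier_mat r (dim_col A) \<and>
     zero_one_mat A1 \<and> zero_one_mat A2 \<and> A = A1 * A2)"

definition real_rank :: "real mat \<Rightarrow> nat" where
  "real_rank A = vec_space.rank (dim_row A) A"

end

theory Submission
  imports Defs
begin

text \<open>Put \<open>g\<^sub>i = gcd n\<^sub>i k\<^sub>i\<close> and call an interval of \<open>g\<^sub>i\<close> consecutive columns of block \<open>i\<close> that does not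
  wrap around a tile; there are \<open>\<Sum>i. n\<^sub>i - g\<^sub>i + 1\<close> tiles. The ones of a row of \<open>M\<close> fill every
  foreign block and form a cyclic interval of length \<open>n\<^sub>i - k\<^sub>i\<close>, a multiple of \<open>g\<^sub>i\<close>, in its own block
  \<open>i\<close>. If this interval wraps around, cutting it into tiles may leave a remainder
  \<open>[0, r) \<union> [n\<^sub>i - g\<^sub>i + r, n\<^sub>i)\<close> with \<open>0 < r < g\<^sub>i\<close>. Taking the union of these remainders over all blocks
  gives one shared set for each \<open>r\<close>, and what it leaves in a foreign block still splits into tiles.
  So the rows are disjoint unions of tiles and of \<open>Max d - 1\<close> shared sets.

  Conversely the tiles are linearly independent and lie in the column space of \<open>M\<close>, so their number is
  a lower bound for the real rank: unless \<open>M = 0\<close> the all-ones vector is in the column space, hence so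
  are the columns of the circulant blocks, and Bezout's identity turns these into tiles.\<close>

section \<open>Bounds on the real and the binary rank\<close>

lemma (in vec_space) mult_mat_vec_in_span_cols:
  assumes A: "A \<in> carrier_mat n nc" and v: "v \<in> carrier_vec nc"
  shows "A *\<^sub>v v \<in> span (set (cols A))"
  using A v col_space_eq[OF A] by (auto simp: col_space_def)

lemma (in vec_space) rank_mult_le_left:
  assumes A: "A \<in> carrier_mat n nc" and B: "B \<in> carrier_mat nc l"
  shows "rank (A * B) \<le> rank A"
proof -
  let ?S = "span (set (cols A))" and ?T = "span (set (cols (A * B)))"
  have C: "set (cols A) \<subseteq> carrier_vec n" using A cols_dim by blast
  have C': "set (cols (A * B)) \<subseteq> carrier_vec n" using A cols_dim[of "A * B"] by simp
  have "set (cols (A * B)) \<subseteq> ?S"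
  proof
    fix x assume "x \<in> set (cols (A * B))"
    then obtain j where j: "j < l" "x = col (A * B) j"
      using B by (auto simp: cols_def)
    then have "x = A *\<^sub>v col B j" using A B col_mult2 by blast
    then show "x \<in> ?S" using mult_mat_vec_in_span_cols[OF A] B j by auto
  qed
  then have sub: "?T \<subseteq> ?S"
    by (simp add: C span_is_submodule span_is_subset)
  have S: "subspace class_ring ?S V" and T: "subspace class_ring ?T V"
    using C C' span_is_subspace by auto
  show ?thesis
    unfolding rank_def
    by (rule vectorspace.subspace_dim[OF subspace_is_vs[OF S] nested_subspaces[OF S T sub],
          simplified])
      (use A B fin_dim_span_cols mult_carrier_mat in blast)+
qed

lemma (in vec_space) rank_eq_if_kernel_trivial:
  assumes A: "A \<in> carrier_mat n nc"
    and ker: "\<And>v. v \<in> carrier_vec nc \<Longrightarrow> A *\<^sub>v v = 0\<^sub>v n \<Longrightarrow> v = 0\<^sub>v nc"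
  shows "rank A = nc"
proof (rule lin_indpt_full_rank[OF A])
  \<comment> \<open>Independence is stated for the set of columns, which would hide repetitions, so
    these are excluded first: equal columns \<open>i\<close> and \<open>j\<close> would put the
    difference of two unit vectors into the kernel.\<close>
  show d: "distinct (cols A)"
  proof (rule ccontr)
    assume "\<not> distinct (cols A)"
    then obtain i j where ij: "i < nc" "j < nc" "i \<noteq> j" "col A i = col A j"
      using A by (auto simp: distinct_conv_nth)
    have "A *\<^sub>v (unit_vec nc i - unit_vec nc j) = 0\<^sub>v n"
    proof (rule eq_vecI)
      fix r assume "r < dim_vec (0\<^sub>v n :: 'a vec)"
      then show "(A *\<^sub>v (unit_vec nc i - unit_vec nc j)) $ r = 0\<^sub>v n $ r"
        using A ij(1-3) arg_cong[OF ij(4), of "\<lambda>v. v $ r"] by (simp add: mult_minus_distrib_mat_vec)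
    qed (use A in simp)
    then have "unit_vec nc i - unit_vec nc j = (0\<^sub>v nc :: 'a vec)"
      by (intro ker) auto
    then have "(unit_vec nc i - unit_vec nc j) $ i = (0 :: 'a)" using ij by simp
    then show False using ij by simp
  qed
  show "lin_indpt (set (cols A))"
    using lin_depE[OF A _ d] ker by metis
qed

text \<open>The column space of a matrix with rows and columns indexed by \<open>P\<close>.
  Functions replace vectors so that pairs of block and position can serve as indices; values outside
  \<open>P\<close> do not matter.\<close>

definition in_col_space :: "'a set \<Rightarrow> ('a \<Rightarrow> 'a \<Rightarrow> real) \<Rightarrow> ('a \<Rightarrow> real) \<Rightarrow> bool" where
  "in_col_space P F f \<longleftrightarrow> (\<exists>x. \<forall>p\<in>P. f p = (\<Sum>q\<in>P. F p q * x q))"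

text \<open>The functions \<open>E t\<close> become the columns of a matrix \<open>T\<close>. Lying
  in the column space gives a factorization \<open>T = M * Y\<close>, and independence gives
  \<open>T\<close> full column rank, so \<open>card I = rank T \<le> rank M\<close>.\<close>

lemma card_le_real_rank:
  fixes M :: "real mat" and E :: "'b \<Rightarrow> 'a \<Rightarrow> real"
  assumes M: "M \<in> carrier_mat N N" and \<phi>: "bij_betw \<phi> {..<N} P"
    and entry: "\<And>p q. p < N \<Longrightarrow> q < N \<Longrightarrow> M $$ (p, q) = F (\<phi> p) (\<phi> q)"
    and fin: "finite I"
    and col: "\<And>t. t \<in> I \<Longrightarrow> in_col_space P F (E t)"
    and indep: "\<And>c. (\<And>p. p \<in> P \<Longrightarrow> (\<Sum>t\<in>I. c t * E t p) = 0) \<Longrightarrow> (\<And>t. t \<in> I \<Longrightarrow> c t = 0)"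
  shows "card I \<le> real_rank M"
proof -
  let ?R = "card I"
  obtain e where e: "bij_betw e {..<?R} I"
    using ex_bij_betw_nat_finite[OF fin] by (auto simp: atLeast0LessThan)
  interpret vec_space "TYPE(real)" N .
  have "\<forall>t\<in>I. \<exists>x. \<forall>p\<in>P. E t p = (\<Sum>q\<in>P. F p q * x q)"
    using col by (simp add: in_col_space_def)
  then obtain X where X: "\<And>t p. t \<in> I \<Longrightarrow> p \<in> P \<Longrightarrow> E t p = (\<Sum>q\<in>P. F p q * X t q)"
    by metis
  define T where "T = mat N ?R (\<lambda>(p, t). E (e t) (\<phi> p))"
  define Y where "Y = mat N ?R (\<lambda>(q, t). X (e t) (\<phi> q))"
  have TY: "T \<in> carrier_mat N ?R" "Y \<in> carrier_mat N ?R" by (auto simp: T_def Y_def)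
  have "T = M * Y"
  proof (rule eq_matI)
    fix p t assume "p < dim_row (M * Y)" "t < dim_col (M * Y)"
    then have pt: "p < N" "t < ?R" using M TY by auto
    then have "\<phi> p \<in> P" "e t \<in> I" using bij_betwE[OF \<phi>] bij_betwE[OF e] by auto
    then have "T $$ (p, t) = (\<Sum>q\<in>P. F (\<phi> p) q * X (e t) q)"
      using pt X by (simp add: T_def)
    also have "\<dots> = (\<Sum>q<N. F (\<phi> p) (\<phi> q) * X (e t) (\<phi> q))"
      by (rule sum.reindex_bij_betw[OF \<phi>, symmetric])
    also have "\<dots> = (M * Y) $$ (p, t)"
      using pt M TY by (simp add: scalar_prod_def entry Y_def atLeast0LessThan)
    finally show "T $$ (p, t) = (M * Y) $$ (p, t)" .
  qed (use M TY in auto)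
  moreover have "rank T = ?R"
  proof (rule rank_eq_if_kernel_trivial[OF TY(1)])
    fix v assume v: "v \<in> carrier_vec ?R" "T *\<^sub>v v = 0\<^sub>v N"
    define c where "c = (\<lambda>t. v $ inv_into {..<?R} e t)"
    have ce: "c (e t) = v $ t" if "t < ?R" for t
      using that e by (simp add: c_def bij_betw_inv_into_left)
    have "(\<Sum>t\<in>I. c t * E t p) = 0" if "p \<in> P" for p
    proof -
      obtain p' where p': "p' < N" "p = \<phi> p'"
        using \<phi> \<open>p \<in> P\<close> by (auto simp: bij_betw_def)
      have "(\<Sum>t\<in>I. c t * E t p) = (\<Sum>t<?R. c (e t) * E (e t) p)"
        by (rule sum.reindex_bij_betw[OF e, symmetric])
      also have "\<dots> = (T *\<^sub>v v) $ p'"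
        using p' v(1) by (simp add: T_def scalar_prod_def atLeast0LessThan ce mult.commute)
      finally show ?thesis using v p' by simp
    qed
    then have "c t = 0" if "t \<in> I" for t using indep that by blast
    then have "v $ t = 0" if "t < ?R" for t
      using that ce bij_betwE[OF e] by (metis lessThan_iff)
    then show "v = 0\<^sub>v ?R" using v by (intro eq_vecI) auto
  qed
  ultimately show ?thesis
    using rank_mult_le_left[OF M TY(2)] M by (simp add: real_rank_def)
qed

lemma in_col_space_col:
  assumes "finite P" "q \<in> P"
  shows "in_col_space P F (\<lambda>p. F p q)"
  unfolding in_col_space_def
  by (rule exI[of _ "\<lambda>q'. if q' = q then 1 else 0"]) (use assms in \<open>simp add: if_distrib cong: if_cong\<close>)

lemma in_col_space_lincomb:
  assumes "in_col_space P F f" "in_col_space P F g"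
  shows "in_col_space P F (\<lambda>p. \<alpha> * f p + \<beta> * g p)"
proof -
  obtain x y where "\<forall>p\<in>P. f p = (\<Sum>q\<in>P. F p q * x q)" "\<forall>p\<in>P. g p = (\<Sum>q\<in>P. F p q * y q)"
    using assms by (auto simp: in_col_space_def)
  then show ?thesis
    unfolding in_col_space_def
    by (intro exI[of _ "\<lambda>q. \<alpha> * x q + \<beta> * y q"])
      (simp add: sum.distrib sum_distrib_left algebra_simps)
qed

lemma in_col_space_sum:
  assumes "\<And>l. l \<in> L \<Longrightarrow> in_col_space P F (f l)"
  shows "in_col_space P F (\<lambda>p. \<Sum>l\<in>L. f l p)"
proof -
  have z: "in_col_space P F (\<lambda>p. 0)" by (auto simp: in_col_space_def intro: exI[of _ "\<lambda>_. 0"])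
  show ?thesis
    using assms
  proof (induction L rule: infinite_finite_induct)
    case (insert l L)
    then show ?case
      using in_col_space_lincomb[of P F "f l" "\<lambda>p. \<Sum>l\<in>L. f l p" 1 1] by simp
  qed (simp_all add: z)
qed

lemma in_col_space_cong:
  assumes "in_col_space P F f" "\<And>p. p \<in> P \<Longrightarrow> f p = g p"
  shows "in_col_space P F g"
  using assms by (simp add: in_col_space_def)

text \<open>The two 0,1 factors are the incidence matrices "row \<open>p\<close> uses set
  \<open>t\<close>" and "set \<open>t\<close> contains column \<open>q\<close>". Since
  \<open>F p q\<close> counts the used sets that contain \<open>q\<close>, a 0,1 matrix
  \<open>F\<close> forces the sets used by one row to be disjoint.\<close>

lemma binary_rank_le_card:
  fixes M :: "real mat" and E :: "'b \<Rightarrow> 'a \<Rightarrow> bool"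
  assumes M: "M \<in> carrier_mat N N" and \<phi>: "bij_betw \<phi> {..<N} P"
    and entry: "\<And>p q. p < N \<Longrightarrow> q < N \<Longrightarrow> M $$ (p, q) = F (\<phi> p) (\<phi> q)"
    and fin: "finite I"
    and decomp: "\<And>p q. p \<in> P \<Longrightarrow> q \<in> P \<Longrightarrow> F p q = (\<Sum>t\<in>I. of_bool (S p t \<and> E t q))"
  shows "binary_rank M \<le> card I"
proof -
  let ?R = "card I"
  obtain e where e: "bij_betw e {..<?R} I"
    using ex_bij_betw_nat_finite[OF fin] by (auto simp: atLeast0LessThan)
  define A where "A = (mat N ?R (\<lambda>(p, t). of_bool (S (\<phi> p) (e t))) :: real mat)"
  define B where "B = (mat ?R N (\<lambda>(t, q). of_bool (E (e t) (\<phi> q))) :: real mat)"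
  have AB: "A \<in> carrier_mat N ?R" "B \<in> carrier_mat ?R N" by (auto simp: A_def B_def)
  have "zero_one_mat A" "zero_one_mat B"
    by (auto simp: zero_one_mat_def elements_mat_def A_def B_def)
  moreover have "M = A * B"
  proof (rule eq_matI)
    fix p q assume "p < dim_row (A * B)" "q < dim_col (A * B)"
    then have pq: "p < N" "q < N" using AB by auto
    then have "M $$ (p, q) = (\<Sum>t\<in>I. of_bool (S (\<phi> p) t \<and> E t (\<phi> q)))"
      using entry decomp bij_betwE[OF \<phi>] by simp
    also have "\<dots> = (\<Sum>t<?R. of_bool (S (\<phi> p) (e t) \<and> E (e t) (\<phi> q)))"
      by (rule sum.reindex_bij_betw[OF e, symmetric])
    also have "\<dots> = (A * B) $$ (p, q)"
      using pq by (simp add: A_def B_def scalar_prod_def atLeast0LessThan of_bool_conj)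
    finally show "M $$ (p, q) = (A * B) $$ (p, q)" .
  qed (use M AB in auto)
  ultimately show ?thesis
    unfolding binary_rank_def using M AB by (intro Least_le) auto
qed

section \<open>Flat indices of a block diagonal matrix as pairs of block and position\<close>

lemma diag_block_mat_index_bij:
  fixes A :: "'i \<Rightarrow> 'a :: zero mat"
  assumes "distinct xs" "\<And>x. x \<in> set xs \<Longrightarrow> square_mat (A x)"
  shows "\<exists>\<phi>. bij_betw \<phi> {..<dim_row (diag_block_mat (map A xs))} (SIGMA x:set xs. {..<dim_row (A x)}) \<and>
    (\<forall>p < dim_row (diag_block_mat (map A xs)). \<forall>q < dim_row (diag_block_mat (map A xs)).
      diag_block_mat (map A xs) $$ (p, q) =
        (if fst (\<phi> p) = fst (\<phi> q) then A (fst (\<phi> p)) $$ (snd (\<phi> p), snd (\<phi> q)) else 0))"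
  using assms
proof (induction xs)
  case Nil
  then show ?case by (auto simp: bij_betw_def)
next
  case (Cons x xs)
  let ?D = "diag_block_mat (map A xs)" and ?D' = "diag_block_mat (map A (x # xs))"
  let ?N = "dim_row ?D" and ?n = "dim_row (A x)"
  let ?P = "SIGMA y:set xs. {..<dim_row (A y)}"
  obtain \<phi> where \<phi>: "bij_betw \<phi> {..<?N} ?P"
    and D: "\<forall>p<?N. \<forall>q<?N. ?D $$ (p, q) =
        (if fst (\<phi> p) = fst (\<phi> q) then A (fst (\<phi> p)) $$ (snd (\<phi> p), snd (\<phi> q)) else 0)"
    using Cons by auto
  have sq: "dim_col (A x) = ?n" "dim_col ?D = ?N"
    using Cons.prems diag_block_mat_square[of "map A xs"] by auto
  define \<psi> where "\<psi> p = (if p < ?n then (x, p) else \<phi> (p - ?n))" for p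
  have mem: "\<phi> (p - ?n) \<in> ?P" if "\<not> p < ?n" "p < ?n + ?N" for p
    using bij_betwE[OF \<phi>] that by auto
  have "bij_betw \<psi> ({..<?n} \<union> {?n..<?n + ?N}) ({x} \<times> {..<?n} \<union> ?P)"
  proof (rule bij_betw_combine)
    show "bij_betw \<psi> {..<?n} ({x} \<times> {..<?n})"
      by (rule bij_betwI[of _ _ _ snd]) (auto simp: \<psi>_def)
    have "bij_betw (\<lambda>p. p - ?n) {?n..<?n + ?N} {..<?N}"
      by (rule bij_betwI[of _ _ _ "\<lambda>p. p + ?n"]) auto
    then have "bij_betw (\<phi> \<circ> (\<lambda>p. p - ?n)) {?n..<?n + ?N} ?P"
      using \<phi> by (rule bij_betw_trans)
    then show "bij_betw \<psi> {?n..<?n + ?N} ?P"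
      by (rule bij_betw_cong[THEN iffD1, rotated]) (auto simp: \<psi>_def)
    show "{x} \<times> {..<?n} \<inter> ?P = {}" using Cons.prems by auto
  qed
  moreover have "{..<?n} \<union> {?n..<?n + ?N} = {..<dim_row ?D'}" by (auto simp: Let_def)
  moreover have "{x} \<times> {..<?n} \<union> ?P = (SIGMA y:set (x # xs). {..<dim_row (A y)})" by auto
  ultimately have "bij_betw \<psi> {..<dim_row ?D'} (SIGMA y:set (x # xs). {..<dim_row (A y)})"
    by simp
  moreover have "?D' $$ (p, q) =
        (if fst (\<psi> p) = fst (\<psi> q) then A (fst (\<psi> p)) $$ (snd (\<psi> p), snd (\<psi> q)) else 0)"
    if "p < ?n + ?N" "q < ?n + ?N" for p q
  proof -
    \<comment> \<open>As the labels are distinct, no index behind the first block carries the label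
      \<open>x\<close>; mixed pairs of indices therefore fall under the zero case.\<close>
    have "fst (\<phi> (r - ?n)) \<noteq> x" if "\<not> r < ?n" "r < ?n + ?N" for r
      using mem[OF that] Cons.prems by auto
    then show ?thesis
      using that D by (auto simp: Let_def sq \<psi>_def dest: sym)
  qed
  ultimately show ?case by (intro exI[of _ \<psi>]) (simp add: Let_def)
qed


section \<open>Cyclic intervals and counting modulo \<open>n\<close>\<close>

text \<open>For \<open>a < n\<close> and \<open>b < n\<close>: \<open>b\<close> is among the
  \<open>k\<close> positions that start at \<open>a\<close> and continue cyclically. The formula is
  the test in \<open>circ_mat\<close>, so row \<open>a\<close> of the circulant block has its ones
  exactly there.\<close>

definition cyclic_within :: "nat \<Rightarrow> nat \<Rightarrow> nat \<Rightarrow> nat \<Rightarrow> bool" where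
  "cyclic_within n k a b \<longleftrightarrow> (b + n - a) mod n < k"

lemma cyclic_within_iff:
  assumes "a < n" "b < n" "k \<le> n"
  shows "cyclic_within n k a b \<longleftrightarrow> a \<le> b \<and> b < a + k \<or> b + n < a + k"
proof (cases "a \<le> b")
  case True
  then have "(b + n - a) mod n = (b - a + n) mod n" by (simp only: add_diff_assoc2)
  also have "\<dots> = (b - a) mod n" by (rule mod_add_self2)
  also have "\<dots> = b - a" using assms by (intro mod_less) linarith
  finally show ?thesis unfolding cyclic_within_def using assms True by linarith
next
  case False
  then have "(b + n - a) mod n = b + n - a" using assms by (intro mod_less) linarith
  then show ?thesis unfolding cyclic_within_def using assms False by linarith
qed

lemma sum_cyclic_within:
  assumes "a < n" "k \<le> n"
  shows "(\<Sum>b<n. of_bool (cyclic_within n k a b)) = (of_nat k :: 'a :: semiring_1)"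
proof -
  have "{b. b < n \<and> cyclic_within n k a b} = {a..<min n (a + k)} \<union> {..<a + k - n}"
    using assms by (auto simp: cyclic_within_iff)
  moreover have "card ({a..<min n (a + k)} \<union> {..<a + k - n}) = k"
    using assms by (subst card_Un_disjoint) auto
  moreover have "(\<Sum>b<n. of_bool (cyclic_within n k a b)) = (of_nat (card {b. b < n \<and> cyclic_within n k a b}) :: 'a)"
    by (simp add: of_bool_def sum.If_cases lessThan_def Int_def)
  ultimately show ?thesis by simp
qed

text \<open>The left side counts the multiples of \<open>n\<close> in \<open>(x - k, x]\<close>. As
  \<open>k \<le> n\<close> there is at most one, and the only candidate is
  \<open>x - x mod n\<close>.\<close>

lemma div_diff_eq_of_bool_mod:
  fixes x k n :: int
  assumes "0 < n" "0 \<le> k" "k \<le> n"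
  shows "x div n - (x - k) div n = of_bool (x mod n < k)"
proof -
  have x: "x - k = x div n * n + (x mod n - k)" by (simp add: algebra_simps)
  have r: "0 \<le> x mod n" "x mod n < n" using assms by auto
  have "(x - k) div n = x div n + (x mod n - k) div n"
    unfolding x using assms by simp
  moreover have "(x mod n - k) div n = - of_bool (x mod n < k)"
    using assms r by (cases "x mod n < k") (auto intro!: int_div_pos_eq[where r = "x mod n - k + n"])
  ultimately show ?thesis by simp
qed

text \<open>Each summand is a difference of two quotients by \<open>n\<close> whose arguments differ
  by \<open>k\<close>, so the sum telescopes.\<close>

lemma sum_of_bool_mod_progression:
  fixes x k n :: int
  assumes "0 < n" "0 \<le> k" "k \<le> n"
  shows "(\<Sum>l<p. of_bool ((x + int l * k) mod n < k)) = (x - k + int p * k) div n - (x - k) div n"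
proof (induction p)
  case (Suc p)
  have "of_bool ((x + int p * k) mod n < k) = (x + int p * k) div n - (x + int p * k - k) div n"
    using div_diff_eq_of_bool_mod[OF assms] by simp
  then show ?case using Suc by (simp add: algebra_simps)
qed simp

text \<open>A column is among the \<open>k\<close> positions from \<open>a\<close> on iff
  \<open>a\<close> is among the \<open>k\<close> positions ending at that column. The
  \<open>p\<close> intervals with these ends follow one another, start at \<open>s\<close> and have
  total length \<open>q * n + g\<close>: they make \<open>q\<close> full turns and pass once more
  through \<open>[s, s + g)\<close>.\<close>

lemma sum_cyclic_within_progression:
  assumes "a < n" "0 < k" "k \<le> n" "0 < g" "s + g \<le> n" and bezout: "p * k = q * n + g"
  shows "(\<Sum>l<p. of_bool (cyclic_within n k a ((s + k - 1 + l * k) mod n))) =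
    int q + of_bool (s \<le> a \<and> a < s + g)"
proof -
  \<comment> \<open>The offset from \<open>a\<close> to the end of the first interval, taken in the
    integers because it can be negative.\<close>
  define x where "x = int s + int k - 1 - int a"
  have "cyclic_within n k a ((s + k - 1 + l * k) mod n) \<longleftrightarrow> (x + int l * int k) mod int n < int k" for l
  proof -
    let ?c = "s + k - 1 + l * k"
    have "int (?c mod n + n - a) = int (?c mod n) + int n - int a" using assms by simp
    then have "int ((?c mod n + n - a) mod n) = (int ?c mod int n + int n - int a) mod int n"
      by (simp add: zmod_int)
    also have "\<dots> = (int ?c - int a) mod int n"
      by (metis add_diff_eq diff_add_eq mod_add_self2 mod_diff_left_eq)
    also have "int ?c - int a = x + int l * int k" using assms by (simp add: x_def)
    finally show ?thesis unfolding cyclic_within_def by (metis of_nat_less_iff)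
  qed
  then have "(\<Sum>l<p. of_bool (cyclic_within n k a ((s + k - 1 + l * k) mod n))) =
    (x - int k + int p * int k) div int n - (x - int k) div int n"
    using sum_of_bool_mod_progression[of "int n" "int k" x p] assms by simp
  also have "x - int k + int p * int k = (x - int k + int g) + int q * int n"
    using arg_cong[OF bezout, of int] by simp
  also have "(\<dots>) div int n = int q + (x - int k + int g) div int n" using assms by simp
  also have "\<dots> - (x - int k) div int n = int q + of_bool ((x - int k + int g) mod int n < int g)"
    using div_diff_eq_of_bool_mod[of "int n" "int g" "x - int k + int g"] assms by simp
  also have "(x - int k + int g) mod int n < int g \<longleftrightarrow> s \<le> a \<and> a < s + g"
  proof (cases "a < s + g")
    case True
    then have "(x - int k + int g) mod int n = int s + int g - 1 - int a"
      using assms by (auto simp: x_def intro!: mod_pos_pos_trivial)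
    then show ?thesis using True by auto
  next
    case False
    \<comment> \<open>Here \<open>s + g - 1 - a\<close> is negative; adding \<open>n\<close> once
      yields its residue, which is at least \<open>g\<close>.\<close>
    have "(x - int k + int g) mod int n = (x - int k + int g + int n) mod int n" by simp
    also have "\<dots> = x - int k + int g + int n"
      using False assms by (intro mod_pos_pos_trivial) (auto simp: x_def)
    finally have "(x - int k + int g) mod int n = int s + int g - 1 - int a + int n"
      by (simp add: x_def)
    then show ?thesis using False assms by auto
  qed
  finally show ?thesis .
qed

section \<open>Tiles of an interval: partition and independence\<close>

lemma sum_interval_tiling:
  fixes g x y n b :: nat
  assumes "0 < g" "x \<le> y" "g dvd y - x" "y \<le> n"
  shows "(\<Sum>s\<le>n - g. of_bool ((x \<le> s \<and> s < y \<and> g dvd s - x) \<and> s \<le> b \<and> b < s + g)) =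
    (of_bool (x \<le> b \<and> b < y) :: 'a :: semiring_1)"
proof -
  \<comment> \<open>Since \<open>g\<close> divides \<open>y - x\<close>, the last tile does not
    stick out beyond \<open>y\<close>.\<close>
  have next_le: "s + g \<le> y" if s: "x \<le> s" "s < y" "g dvd s - x" for s
  proof -
    have "g dvd (y - x) - (s - x)" using assms(3) s(3) by (rule dvd_diff_nat)
    then show ?thesis using s assms(2) dvd_imp_le[of g "y - s"] by simp
  qed
  \<comment> \<open>\<open>b\<close> rounded down to a point congruent to \<open>x\<close> modulo
    \<open>g\<close>: the only possible start of a tile that contains \<open>b\<close>.\<close>
  define s0 where "s0 = b - (b - x) mod g"
  have s0: "(x \<le> s \<and> s < y \<and> g dvd s - x) \<and> s \<le> b \<and> b < s + g \<longleftrightarrow> s = s0 \<and> x \<le> b \<and> b < y" for s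
  proof
    assume A: "(x \<le> s \<and> s < y \<and> g dvd s - x) \<and> s \<le> b \<and> b < s + g"
    then obtain c where c: "s - x = g * c" by (auto simp: dvd_def)
    have "b - x = (b - s) + g * c" using A unfolding c[symmetric] by simp
    then have "(b - x) mod g = ((b - s) + g * c) mod g" by (rule arg_cong)
    also have "\<dots> = (b - s) mod g" by (rule mod_mult_self2)
    also have "\<dots> = b - s" using A by (intro mod_less) linarith
    finally have "s0 = b - (b - s)" by (simp only: s0_def)
    moreover have "s + g \<le> y" using A next_le by blast
    ultimately show "s = s0 \<and> x \<le> b \<and> b < y" using A by linarith
  next
    assume A: "s = s0 \<and> x \<le> b \<and> b < y"
    have m: "(b - x) mod g \<le> b - x" "(b - x) mod g < g" using assms(1) by simp_all
    have "s - x = (b - x) - (b - x) mod g" using A m unfolding s0_def by linarith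
    then have "g dvd s - x" by (simp only: dvd_minus_mod)
    moreover have "x \<le> s \<and> s < y \<and> s \<le> b \<and> b < s + g"
      using A m unfolding s0_def by linarith
    ultimately show "(x \<le> s \<and> s < y \<and> g dvd s - x) \<and> s \<le> b \<and> b < s + g" by blast
  qed
  have "s0 \<le> n - g" if "x \<le> b" "b < y"
  proof -
    have "x \<le> s0 \<and> s0 < y \<and> g dvd s0 - x" using s0[of s0] that by blast
    then show ?thesis using next_le[of s0] assms(4) by linarith
  qed
  then have "(\<Sum>s\<le>n - g. of_bool (s = s0 \<and> x \<le> b \<and> b < y)) =
      (\<Sum>s\<in>{..n - g}. if s = s0 then of_bool (x \<le> b \<and> b < y) else (0 :: 'a))"
    by (intro sum.cong) auto
  then show ?thesis
    unfolding s0 using \<open>x \<le> b \<Longrightarrow> b < y \<Longrightarrow> s0 \<le> n - g\<close>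
    by (cases "x \<le> b \<and> b < y") auto
qed

text \<open>The system is triangular: no tile starting after \<open>s\<close> contains
  \<open>s\<close>, and the coefficients of those starting before \<open>s\<close> vanish by
  induction, so evaluation at \<open>s\<close> leaves only \<open>c s\<close>.\<close>

lemma interval_tiles_independent:
  fixes c :: "nat \<Rightarrow> real"
  assumes "0 < g" "g \<le> n"
    and zero: "\<And>a. a < n \<Longrightarrow> (\<Sum>s\<le>n - g. c s * of_bool (s \<le> a \<and> a < s + g)) = 0"
  shows "s \<le> n - g \<Longrightarrow> c s = 0"
proof (induction s rule: less_induct)
  case (less s)
  have "(\<Sum>t\<le>n - g. c t * of_bool (t \<le> s \<and> s < t + g)) = (\<Sum>t\<le>n - g. if t = s then c s else 0)"
  proof (intro sum.cong refl)
    fix t assume "t \<in> {..n - g}"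
    then show "c t * of_bool (t \<le> s \<and> s < t + g) = (if t = s then c s else 0)"
      using less.IH[of t] assms(1) by (cases t s rule: linorder_cases) auto
  qed
  then show ?case using zero[of s] less.prems assms by simp
qed


section \<open>Combinatorial model of the complement matrix\<close>

locale circulant_blocks =
  fixes J :: "nat set" and k n :: "nat \<Rightarrow> nat"
  assumes finite_J: "finite J"
    and k_pos: "i \<in> J \<Longrightarrow> 0 < k i"
    and k_le: "i \<in> J \<Longrightarrow> k i \<le> n i"
begin

text \<open>Unlike \<open>d\<close> in the theorem, this is \<open>n i\<close> when
  \<open>n i = k i\<close>; such a block has a single tile.\<close>

definition g :: "nat \<Rightarrow> nat" where
  "g i = gcd (n i) (k i)"

definition positions :: "(nat \<times> nat) set" where
  "positions = (SIGMA i:J. {..<n i})"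

definition entry :: "nat \<times> nat \<Rightarrow> nat \<times> nat \<Rightarrow> real" where
  "entry p q = of_bool (\<not> (fst p = fst q \<and> cyclic_within (n (fst p)) (k (fst p)) (snd p) (snd q)))"

definition tiles :: "(nat \<times> nat) set" where
  "tiles = (SIGMA j:J. {..n j - g j})"

definition in_tile :: "nat \<times> nat \<Rightarrow> nat \<times> nat \<Rightarrow> bool" where
  "in_tile t q \<longleftrightarrow> fst t = fst q \<and> snd t \<le> snd q \<and> snd q < snd t + g (fst t)"

text \<open>Block by block, the shared set with index \<open>r\<close> is the cyclic interval of length \<open>g j\<close> that wraps
  around the end of the block and has its last \<open>r\<close> elements at the beginning; it is empty if \<open>g j \<le> r\<close>.\<close>

definition in_shared :: "nat \<Rightarrow> nat \<times> nat \<Rightarrow> bool" where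
  "in_shared r q \<longleftrightarrow> r < g (fst q) \<and> (snd q < r \<or> n (fst q) - g (fst q) + r \<le> snd q)"

text \<open>The value 0 means that the row uses no shared set.\<close>

definition shared_index :: "nat \<times> nat \<Rightarrow> nat" where
  "shared_index p = (if snd p + k (fst p) < n (fst p) then snd p mod g (fst p) else 0)"

text \<open>When \<open>g j\<close> divides \<open>y - x\<close>, these are the starts of the tiles
  that partition \<open>[x, y)\<close>.\<close>

definition tile_start :: "nat \<Rightarrow> nat \<Rightarrow> nat \<Rightarrow> nat \<Rightarrow> bool" where
  "tile_start j x y s \<longleftrightarrow> x \<le> s \<and> s < y \<and> g j dvd s - x"

text \<open>Row \<open>(i, a)\<close> has its zeros in block \<open>i\<close> on the cyclic interval
  of length \<open>k i\<close> from \<open>a\<close> on. If this ends before the block does, the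
  ones wrap around, and removing the shared set leaves \<open>[r, a)\<close> and
  \<open>[a + k i, n i - g i + r)\<close>; for \<open>r = 0\<close> nothing is removed. Otherwise
  the ones form the plain interval \<open>[a + k i - n i, a)\<close>. A foreign block is full except
  for its part of the shared set, which is empty if \<open>g j \<le> r\<close>.\<close>

definition uses_tile :: "nat \<times> nat \<Rightarrow> nat \<times> nat \<Rightarrow> bool" where
  "uses_tile p t = (case (p, t) of ((i, a), (j, s)) \<Rightarrow>
     let r = shared_index p in
     if j = i then
       if a + k i < n i
       then tile_start i r a s \<or> tile_start i (a + k i) (if r = 0 then n i else n i - g i + r) s
       else tile_start i (a + k i - n i) a s
     else if 0 < r \<and> r < g j then tile_start j r (n j - g j + r) s
     else tile_start j 0 (n j) s)"

lemma g_pos: "i \<in> J \<Longrightarrow> 0 < g i"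
  using k_pos by (simp add: g_def)

lemma g_dvd: "g i dvd n i" "g i dvd k i"
  by (simp_all add: g_def)

lemma g_le: "i \<in> J \<Longrightarrow> g i \<le> n i"
  using k_pos k_le g_dvd(1) by (meson dvd_imp_le less_le_trans)

lemma finite_tiles: "finite tiles"
  by (simp add: tiles_def finite_J)

lemma finite_positions: "finite positions"
  by (simp add: positions_def finite_J)

section \<open>Partition of each row into tiles and a shared set\<close>

lemma sum_tiles:
  assumes "j \<in> J"
  shows "(\<Sum>t\<in>tiles. of_bool (U t \<and> in_tile t (j, b))) =
    (\<Sum>s\<le>n j - g j. of_bool (U (j, s) \<and> s \<le> b \<and> b < s + g j) :: real)"
proof -
  have "(\<Sum>t\<in>tiles. of_bool (U t \<and> in_tile t (j, b)) :: real) =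
    (\<Sum>i\<in>J. \<Sum>s\<le>n i - g i. of_bool (U (i, s) \<and> in_tile (i, s) (j, b)))"
    unfolding tiles_def by (subst sum.Sigma) (auto simp: finite_J)
  also have "\<dots> = (\<Sum>i\<in>J. if i = j then \<Sum>s\<le>n j - g j. of_bool (U (j, s) \<and> s \<le> b \<and> b < s + g j) else 0)"
    by (intro sum.cong) (auto simp: in_tile_def)
  finally show ?thesis using assms finite_J by simp
qed

lemma sum_tile_start:
  assumes "j \<in> J" "x \<le> y" "g j dvd y - x" "y \<le> n j"
  shows "(\<Sum>s\<le>n j - g j. of_bool (tile_start j x y s \<and> s \<le> b \<and> b < s + g j)) =
    (of_bool (x \<le> b \<and> b < y) :: real)"
  unfolding tile_start_def using sum_interval_tiling[of "g j"] g_pos assms by blast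

lemma sum_used_tiles:
  assumes p: "(i, a) \<in> positions" and q: "(j, b) \<in> positions"
  defines "r \<equiv> shared_index (i, a)"
  shows "(\<Sum>t\<in>tiles. of_bool (uses_tile (i, a) t \<and> in_tile t (j, b))) =
    entry (i, a) (j, b) - of_bool (0 < r \<and> in_shared r (j, b))"
proof -
  have i: "i \<in> J" "a < n i" and j: "j \<in> J" "b < n j" using p q by (auto simp: positions_def)
  note gi = g_pos[OF i(1)] g_le[OF i(1)] and gj = g_pos[OF j(1)] g_le[OF j(1)]
  let ?T = "\<Sum>s\<le>n j - g j. of_bool (uses_tile (i, a) (j, s) \<and> s \<le> b \<and> b < s + g j) :: real"
  consider (other_shared) "j \<noteq> i" "0 < r" "r < g j" | (other) "j \<noteq> i" "\<not> (0 < r \<and> r < g j)"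
    | (wrap) "j = i" "a + k i < n i" | (nowrap) "j = i" "n i \<le> a + k i"
    by linarith
  then have "?T = entry (i, a) (j, b) - of_bool (0 < r \<and> in_shared r (j, b))"
  proof cases
    case other_shared
    then have "?T = of_bool (r \<le> b \<and> b < n j - g j + r)"
      using sum_tile_start[OF j(1), of r "n j - g j + r" b] gj
      by (simp add: uses_tile_def r_def[symmetric] g_dvd)
    then show ?thesis
      using other_shared by (auto simp: entry_def in_shared_def)
  next
    case other
    then have u: "uses_tile (i, a) (j, s) \<longleftrightarrow> tile_start j 0 (n j) s" for s
      by (auto simp: uses_tile_def r_def[symmetric] Let_def)
    have "?T = of_bool (0 \<le> b \<and> b < n j)"
      unfolding u by (rule sum_tile_start[OF j(1)]) (simp_all add: g_dvd)
    then show ?thesis using other j by (auto simp: entry_def in_shared_def)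
  next
    case nowrap
    have "r = 0" using nowrap by (simp add: r_def shared_index_def)
    have "a - (a + k i - n i) = n i - k i" using nowrap k_le[OF i(1)] i by simp
    then have "?T = of_bool (a + k i - n i \<le> b \<and> b < a)"
      using nowrap sum_tile_start[OF i(1), of "a + k i - n i" a b] i k_le[OF i(1)]
      by (simp add: uses_tile_def g_dvd)
    then show ?thesis
      using nowrap i j k_le[OF i(1)] \<open>r = 0\<close> by (auto simp: entry_def cyclic_within_iff)
  next
    case wrap
    have r: "r = a mod g i" using wrap by (simp add: r_def shared_index_def)
    then have r_le: "r \<le> a" "r < g i" and r_dvd: "g i dvd a - r"
      using gi by (simp_all add: dvd_minus_mod)
    define e where "e = (if r = 0 then n i else n i - g i + r)"
    have e: "e \<le> n i" "a + k i \<le> e" "g i dvd e - (a + k i)"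
    proof -
      \<comment> \<open>This number is a multiple of \<open>g i\<close> and positive, hence at least
        \<open>g i\<close>, which gives \<open>a + k i \<le> n i - g i + r\<close>: the shared set
        does not meet the zeros of the row.\<close>
      have d: "g i dvd n i - k i - (a - r)" using r_dvd g_dvd by (metis dvd_diff_nat)
      have "0 < n i - k i - (a - r)" using wrap by linarith
      then have "g i \<le> n i - k i - (a - r)" using d dvd_imp_le by blast
      moreover have "g i dvd n i - k i - (a - r) - g i" using d by (metis dvd_diff_nat dvd_refl)
      ultimately show "e \<le> n i" "a + k i \<le> e" "g i dvd e - (a + k i)"
        using d r_le gi wrap unfolding e_def by (auto simp: algebra_simps)
    qed
    have "?T = (\<Sum>s\<le>n i - g i. of_bool (tile_start i r a s \<and> s \<le> b \<and> b < s + g i)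
        + of_bool (tile_start i (a + k i) e s \<and> s \<le> b \<and> b < s + g i))"
      using wrap by (intro sum.cong) (auto simp: uses_tile_def r_def[symmetric] e_def tile_start_def)
    also have "\<dots> = of_bool (r \<le> b \<and> b < a) + of_bool (a + k i \<le> b \<and> b < e)"
      using sum_tile_start[OF i(1) r_le(1) r_dvd, of b] i
        sum_tile_start[OF i(1) e(2,3,1), of b] by (simp add: sum.distrib)
    also have "\<dots> = entry (i, a) (j, b) - of_bool (0 < r \<and> in_shared r (j, b))"
      using wrap i j k_le[OF i(1)] r_le e
      by (cases "r = 0") (auto simp: entry_def cyclic_within_iff in_shared_def e_def)
    finally show ?thesis .
  qed
  then show ?thesis using sum_tiles[OF j(1)] by simp
qed

lemma entry_decomposition:
  assumes p: "p \<in> positions" and q: "q \<in> positions"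
    and D: "\<And>i. i \<in> J \<Longrightarrow> k i < n i \<Longrightarrow> g i \<le> D"
  shows "entry p q = (\<Sum>t\<in>tiles <+> {1..<D}. of_bool (case_sum (uses_tile p) (\<lambda>r. r = shared_index p) t \<and>
    case_sum in_tile in_shared t q))"
proof -
  obtain i a j b where pq: "p = (i, a)" "q = (j, b)" by (metis surj_pair)
  have i: "i \<in> J" "a < n i" using p pq by (auto simp: positions_def)
  \<comment> \<open>A nonzero index arises only if \<open>a + k i < n i\<close>. Hence
    \<open>k i < n i\<close>, and the bound by \<open>D\<close> is available for block
    \<open>i\<close>.\<close>
  have "shared_index p < D" if "0 < shared_index p"
    using that pq D[OF i(1)] mod_less_divisor[OF g_pos[OF i(1)], of a]
    by (auto simp: shared_index_def split: if_splits)
  then have "(\<Sum>r\<in>{1..<D}. of_bool (r = shared_index p \<and> in_shared r q)) =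
      (of_bool (0 < shared_index p \<and> in_shared (shared_index p) q) :: real)"
    by (cases "0 < shared_index p") (auto simp: of_bool_conj if_distrib cong: if_cong)
  moreover have "(\<Sum>t\<in>tiles. of_bool (uses_tile p t \<and> in_tile t q)) =
      entry p q - of_bool (0 < shared_index p \<and> in_shared (shared_index p) q)"
    using sum_used_tiles[of i a j b] p q unfolding pq by blast
  ultimately show ?thesis
    by (subst sum.Plus) (simp_all add: finite_tiles del: sum_of_bool_eq)
qed

section \<open>Tiles in the real column space\<close>

text \<open>Give each column of block \<open>j\<close> the weight
  \<open>1 / (k j * \<sigma>)\<close>, where \<open>\<sigma> + 1\<close> is the sum in the
  hypothesis. A row of block \<open>i\<close> then has weighted sum
  \<open>(\<sigma> + 1) / \<sigma>\<close> minus the contribution \<open>1 / \<sigma>\<close> of its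
  \<open>k i\<close> zeros, which is 1.\<close>

lemma ones_in_col_space:
  assumes "(\<Sum>j\<in>J. real (n j) / real (k j)) \<noteq> 1"
  shows "in_col_space positions entry (\<lambda>p. 1)"
proof -
  define \<sigma> where "\<sigma> = (\<Sum>j\<in>J. real (n j) / real (k j)) - 1"
  have \<sigma>: "\<sigma> \<noteq> 0" using assms by (simp add: \<sigma>_def)
  have "(\<Sum>q\<in>positions. entry (i, a) q * (1 / (real (k (fst q)) * \<sigma>))) = 1"
    if "i \<in> J" "a < n i" for i a
  proof -
    have inner: "(\<Sum>b<n j. entry (i, a) (j, b)) = real (n j) - of_bool (j = i) * real (k i)" if "j \<in> J" for j
    proof -
      have "(\<Sum>b<n j. entry (i, a) (j, b)) =
        (\<Sum>b<n j. 1 - of_bool (j = i) * of_bool (cyclic_within (n i) (k i) a b))"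
        by (intro sum.cong) (auto simp: entry_def)
      then show ?thesis
        using sum_cyclic_within[OF \<open>a < n i\<close> k_le[OF \<open>i \<in> J\<close>], where 'a = real]
        by (auto simp: sum_subtractf)
    qed
    have "(\<Sum>q\<in>positions. entry (i, a) q * (1 / (real (k (fst q)) * \<sigma>))) =
      (\<Sum>j\<in>J. \<Sum>b<n j. entry (i, a) (j, b) * (1 / (real (k j) * \<sigma>)))"
      unfolding positions_def by (subst sum.Sigma) (auto simp: finite_J split_def)
    also have "\<dots> = (\<Sum>j\<in>J. (real (n j) - of_bool (j = i) * real (k i)) * (1 / (real (k j) * \<sigma>)))"
      by (intro sum.cong refl) (simp only: sum_distrib_right[symmetric] inner)
    also have "\<dots> = (\<Sum>j\<in>J. real (n j) / real (k j) / \<sigma> - (if j = i then 1 / \<sigma> else 0))"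
    proof (intro sum.cong refl)
      fix j assume "j \<in> J"
      then show "(real (n j) - of_bool (j = i) * real (k i)) * (1 / (real (k j) * \<sigma>)) =
          real (n j) / real (k j) / \<sigma> - (if j = i then 1 / \<sigma> else 0)"
        using k_pos[of j] \<sigma> by (simp add: field_simps)
    qed
    also have "\<dots> = (\<Sum>j\<in>J. real (n j) / real (k j)) / \<sigma> - 1 / \<sigma>"
      using that finite_J by (simp only: sum_subtractf sum_divide_distrib[symmetric]) simp
    also have "\<dots> = \<sigma> / \<sigma>" by (simp only: \<sigma>_def diff_divide_distrib)
    finally show ?thesis using \<sigma> by simp
  qed
  then show ?thesis
    unfolding in_col_space_def
    by (intro exI[of _ "\<lambda>q. 1 / (real (k (fst q)) * \<sigma>)"]) (auto simp: positions_def)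
qed

text \<open>These are the columns of the uncomplemented circulant block diagonal matrix.\<close>

lemma diag_col_in_col_space:
  assumes ones: "in_col_space positions entry (\<lambda>p. 1)" and "j \<in> J" "b < n j"
  shows "in_col_space positions entry (\<lambda>p. 1 - entry p (j, b))"
  using in_col_space_lincomb[OF ones in_col_space_col[OF finite_positions], of "(j, b)" 1 "-1"] assms
  by (simp add: positions_def)

text \<open>Each row of a circulant block has \<open>k j\<close> ones, so the sum of the columns of
  the block is \<open>k j\<close> times its indicator.\<close>

lemma block_in_col_space:
  assumes ones: "in_col_space positions entry (\<lambda>p. 1)" and j: "j \<in> J"
  shows "in_col_space positions entry (\<lambda>p. of_bool (fst p = j))"
proof -
  have "in_col_space positions entry (\<lambda>p. \<Sum>b<n j. 1 - entry p (j, b))"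
    using j by (intro in_col_space_sum diag_col_in_col_space ones) auto
  then have "in_col_space positions entry
      (\<lambda>p. 1 / real (k j) * (\<Sum>b<n j. 1 - entry p (j, b)) + 0 * 1)"
    using ones by (rule in_col_space_lincomb)
  then show ?thesis
  proof (rule in_col_space_cong)
    fix p assume "p \<in> positions"
    then obtain i a where p: "p = (i, a)" "i \<in> J" "a < n i" by (auto simp: positions_def)
    have "(\<Sum>b<n j. 1 - entry p (j, b)) = (\<Sum>b<n j. of_bool (i = j) * of_bool (cyclic_within (n i) (k i) a b))"
      by (intro sum.cong) (auto simp: entry_def p)
    also have "\<dots> = of_bool (i = j) * real (k j)"
      using sum_cyclic_within[OF p(3) k_le[OF p(2)], where 'a = real] by auto
    finally show "1 / real (k j) * (\<Sum>b<n j. 1 - entry p (j, b)) + 0 * 1 = of_bool (fst p = j)"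
      using k_pos[OF j] p by simp
  qed
qed

text \<open>By Bezout, \<open>u\<close> consecutive cyclic intervals of length \<open>k j\<close> cover block \<open>j\<close> exactly \<open>v\<close> times
  and a tile once more.\<close>

lemma tile_in_col_space:
  assumes ones: "in_col_space positions entry (\<lambda>p. 1)" and t: "t \<in> tiles"
  shows "in_col_space positions entry (\<lambda>p. of_bool (in_tile t p))"
proof -
  obtain j s where js: "t = (j, s)" "j \<in> J" "s \<le> n j - g j" using t by (auto simp: tiles_def)
  have n: "0 < n j" "s + g j \<le> n j" using js k_pos[of j] k_le[of j] g_le[of j] by auto
  obtain u v where "k j * u = n j * v + gcd (k j) (n j)"
    using bezout_nat[of "k j" "n j"] k_pos[OF js(2)] by auto
  then have uv: "u * k j = v * n j + g j" by (simp add: g_def gcd.commute mult.commute)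
  \<comment> \<open>Column \<open>c l\<close> has its ones on the \<open>k j\<close> rows that end
    cyclically at \<open>c l\<close>. The offset \<open>k j - 1\<close> makes the first of these
    intervals start at \<open>s\<close>.\<close>
  define c where "c l = (s + k j - 1 + l * k j) mod n j" for l
  have "in_col_space positions entry (\<lambda>p. \<Sum>l<u. 1 - entry p (j, c l))"
    using n js by (intro in_col_space_sum diag_col_in_col_space ones) (auto simp: c_def)
  then have "in_col_space positions entry
      (\<lambda>p. 1 * (\<Sum>l<u. 1 - entry p (j, c l)) + (- real v) * of_bool (fst p = j))"
    by (rule in_col_space_lincomb[OF _ block_in_col_space[OF ones js(2)]])
  then show ?thesis
  proof (rule in_col_space_cong)
    fix p assume "p \<in> positions"
    then obtain i a where p: "p = (i, a)" "i \<in> J" "a < n i" by (auto simp: positions_def)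
    show "1 * (\<Sum>l<u. 1 - entry p (j, c l)) + (- real v) * of_bool (fst p = j) = of_bool (in_tile t p)"
    proof (cases "i = j")
      case True
      have "(\<Sum>l<u. 1 - entry p (j, c l)) =
          real_of_int (\<Sum>l<u. of_bool (cyclic_within (n j) (k j) a (c l)))"
        unfolding of_int_sum by (intro sum.cong) (auto simp: entry_def p True)
      also have "\<dots> = real_of_int (int v + of_bool (s \<le> a \<and> a < s + g j))"
        unfolding c_def
        using sum_cyclic_within_progression[OF _ k_pos k_le g_pos n(2) uv] True p js
        by (intro arg_cong[where f = real_of_int]) blast
      finally show ?thesis using True by (simp add: p js in_tile_def)
    next
      case False
      then show ?thesis by (simp add: entry_def p in_tile_def js)
    qed
  qed
qed

text \<open>Tiles of different blocks are disjoint, so evaluation inside one block reduces the claim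
  to the tiles of an interval.\<close>

lemma tiles_independent:
  assumes zero: "\<And>p. p \<in> positions \<Longrightarrow> (\<Sum>t\<in>tiles. c t * of_bool (in_tile t p)) = (0 :: real)"
    and t: "t \<in> tiles"
  shows "c t = 0"
proof -
  obtain j s where js: "t = (j, s)" "j \<in> J" "s \<le> n j - g j" using t by (auto simp: tiles_def)
  have "(\<Sum>s\<le>n j - g j. c (j, s) * of_bool (s \<le> a \<and> a < s + g j)) = 0" if "a < n j" for a
  proof -
    have "0 = (\<Sum>t\<in>tiles. c t * of_bool (in_tile t (j, a)))"
      using zero js that by (simp add: positions_def)
    also have "\<dots> = (\<Sum>i\<in>J. \<Sum>s\<le>n i - g i. c (i, s) * of_bool (in_tile (i, s) (j, a)))"
      unfolding tiles_def by (subst sum.Sigma) (auto simp: finite_J intro!: sum.cong)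
    also have "\<dots> = (\<Sum>i\<in>J. if i = j then \<Sum>s\<le>n j - g j. c (j, s) * of_bool (s \<le> a \<and> a < s + g j) else 0)"
      by (intro sum.cong) (auto simp: in_tile_def)
    finally show ?thesis using js finite_J by simp
  qed
  from interval_tiles_independent[OF g_pos[OF js(2)] g_le[OF js(2)] this js(3)] show ?thesis
    by (simp add: js)
qed

end

section \<open>Transfer to matrices and comparison of the two ranks\<close>

theorem theorem1p2:
  fixes m :: nat and k n d :: "nat \<Rightarrow> nat" and M :: "real mat"
  assumes "m \<ge> 1"
    and "\<And>i. i \<in> {1..m} \<Longrightarrow> n i \<ge> k i \<and> k i > 0"
    and "M = complement_mat (circ_block_diag m k n)"
    and "\<And>i. i \<in> {1..m} \<Longrightarrow> d i = (if n i > k i then gcd (n i) (k i) else 1)"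
  shows "int (binary_rank M) \<le> int (real_rank M) + int (Max (d ` {1..m})) - 1"
proof -
  let ?J = "{1..m}" and ?D = "Max (d ` {1..m})"
  interpret circulant_blocks ?J k n
    using assms(2) by unfold_locales auto
  define C where "C i = circ_mat (n i) (n i - k i)" for i
  define N where "N = dim_row (circ_block_diag m k n)"
  have dims: "dim_row (C i) = n i" "dim_col (C i) = n i" for i by (simp_all add: C_def circ_mat_def)
  have diag: "circ_block_diag m k n = diag_block_mat (map C [1..<m + 1])"
    unfolding circ_block_diag_def C_def ..
  have xs: "distinct [1..<m + 1]" "set [1..<m + 1] = ?J" by auto
  obtain \<phi> where \<phi>: "bij_betw \<phi> {..<N} positions"
    and C: "\<And>p q. p < N \<Longrightarrow> q < N \<Longrightarrow> circ_block_diag m k n $$ (p, q) =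
        (if fst (\<phi> p) = fst (\<phi> q) then C (fst (\<phi> p)) $$ (snd (\<phi> p), snd (\<phi> q)) else 0)"
    using diag_block_mat_index_bij[OF xs(1), of C]
    unfolding diag[symmetric] N_def[symmetric] positions_def xs(2) by (auto simp: dims)
  have "square_mat (circ_block_diag m k n)"
    unfolding diag by (intro diag_block_mat_square) (auto simp: dims)
  then have carrier: "circ_block_diag m k n \<in> carrier_mat N N" by (auto simp: N_def)
  then have M: "M \<in> carrier_mat N N" by (simp add: assms(3) complement_mat_def)
  \<comment> \<open>As \<open>k i \<le> n i\<close>, the first row of block \<open>i\<close> has
    \<open>n i - (n i - k i) = k i\<close> ones, and the test in \<open>circ_mat\<close> becomes
    \<open>cyclic_within\<close>.\<close>
  have ent: "M $$ (p, q) = entry (\<phi> p) (\<phi> q)" if pq: "p < N" "q < N" for p q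
  proof -
    obtain i a j b where \<phi>pq: "\<phi> p = (i, a)" "\<phi> q = (j, b)" by (metis surj_pair)
    then have "i \<in> ?J" "a < n i" "j \<in> ?J" "b < n j"
      using bij_betwE[OF \<phi>] pq unfolding positions_def by (metis SigmaD1 SigmaD2 lessThan_iff)+
    then show ?thesis
      using pq carrier C[OF pq] k_le[of i] unfolding \<phi>pq
      by (auto simp: assms(3) complement_mat_def entry_def C_def circ_mat_def cyclic_within_def)
  qed
  have D: "d i \<le> ?D" if "i \<in> ?J" for i using that by (intro Max_ge) auto
  have "1 \<le> d 1" using assms(1,4) k_pos[of 1] by (auto simp: Suc_le_eq)
  also have "d 1 \<le> ?D" using assms(1) by (intro D) simp
  finally have D1: "1 \<le> ?D" .
  show ?thesis
  \<comment> \<open>Here \<open>M = 0\<close>, and the all-ones vector is not in its column space.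
    The empty family of rectangles shows that the binary rank is 0.\<close>
  proof (cases "m = 1 \<and> n 1 = k 1")
    case True
    have "binary_rank M \<le> card ({} :: nat set)"
    proof (rule binary_rank_le_card[OF M \<phi> ent])
      fix p q assume "p \<in> positions" "q \<in> positions"
      then show "entry p q = (\<Sum>t\<in>({} :: nat set). of_bool (False \<and> False))"
        using True k_pos[of 1] unfolding positions_def by (auto simp: entry_def cyclic_within_def)
    qed auto
    then show ?thesis using D1 by simp
  next
    case False
    have ge: "1 \<le> real (n j) / real (k j)" if "j \<in> ?J" for j
      using k_pos[OF that] k_le[OF that] by simp
    \<comment> \<open>Every summand is at least 1. The sum exceeds 1 because there are at least two
      blocks or the only block has \<open>n 1 > k 1\<close>.\<close>
    have "1 < (\<Sum>j\<in>?J. real (n j) / real (k j))"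
    proof (cases "m = 1")
      case True
      then show ?thesis using False k_pos[of 1] k_le[of 1] by simp
    next
      case m: False
      have "real m = (\<Sum>j\<in>?J. 1)" by simp
      also have "\<dots> \<le> (\<Sum>j\<in>?J. real (n j) / real (k j))" using ge by (rule sum_mono)
      finally show ?thesis using m assms(1) by linarith
    qed
    then have ones: "in_col_space positions entry (\<lambda>p. 1)"
      by (intro ones_in_col_space) simp
    have "binary_rank M \<le> card (tiles <+> {1..<?D})"
    proof (rule binary_rank_le_card[OF M \<phi> ent])
      have "g i \<le> ?D" if "i \<in> ?J" "k i < n i" for i
        using D[OF that(1)] assms(4)[OF that(1)] that by (simp add: g_def)
      then show "entry p q = (\<Sum>t\<in>tiles <+> {1..<?D}. of_bool
          (case_sum (uses_tile p) (\<lambda>r. r = shared_index p) t \<and> case_sum in_tile in_shared t q))"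
        if "p \<in> positions" "q \<in> positions" for p q
        using entry_decomposition[OF that] by blast
    qed (assumption | intro finite_Plus finite_tiles finite_atLeastLessThan)+
    also have "\<dots> = card tiles + (?D - 1)" by (subst card_Plus[OF finite_tiles]) simp_all
    also have "card tiles \<le> real_rank M"
    proof (rule card_le_real_rank[OF M \<phi> ent finite_tiles tile_in_col_space[OF ones]])
      fix c t
      assume "\<And>p. p \<in> positions \<Longrightarrow> (\<Sum>t\<in>tiles. c t * of_bool (in_tile t p)) = (0 :: real)" "t \<in> tiles"
      then show "c t = 0" by (rule tiles_independent)
    qed
    finally show ?thesis using D1 by linarith
  qed
qed

end
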